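(* There is a constant $c>0$ such that for every positive integer $k$ there is an infinite family $\mathcal{G}_k$ of graphs such that $\{\chi(G^k): G\in\mathcal{G}_k\}$ is unbounded and every $G\in\mathcal{G}_k$ satisfies \[ \chi_{\ell}(G^k) \geq c\, \chi(G^k) \log \chi(G^k). \] (The constant $c$ does not depend on $k$.)
   Context: Graphs are finite and simple. The $k$th power $G^k$ of a graph $G$ is the graph on the same vertex set in which two distinct vertices $u,v$ are adjacent if and only if the distance from $u$ to $v$ in $G$ is at most $k$. $\chi$ denotes the chromatic number. The list-chromatic number $\chi_{\ell}(G)$ is the least $t$ such that for any assignment of lists of size $t$ to the vertices of $G$ there is a proper coloring of $V(G)$ in which the color of each vertex belongs to that vertex's list. $\log$ is the natural logarithm. *)

theory Defs
  imports Complex_Main "Graph_Theory.Graph_Theory"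
begin

text \<open>
  A finite simple graph is a \<^locale>\<open>pair_graph\<close> of the AFP entry Graph-Theory: a finite vertex
  set with a symmetric irreflexive set of arcs \<^typ>\<open>'a \<times> 'a\<close>.  The distance is the
  shortest-path value of that entry for unit weights, with value \<open>\<infinity>\<close> if there is no walk.
\<close>

definition graph_dist :: "'a pair_pre_digraph \<Rightarrow> 'a \<Rightarrow> 'a \<Rightarrow> ereal" where
  "graph_dist G u v = wf_digraph.\<mu> (with_proj G) (\<lambda>_. 1) u v"

definition graph_power :: "'a pair_pre_digraph \<Rightarrow> nat \<Rightarrow> 'a pair_pre_digraph" where
  "graph_power G k =
     \<lparr> pverts = pverts G,
       parcs = {(u, v). u \<in> pverts G \<and> v \<in> pverts G \<and> u \<noteq> v \<and> graph_dist G u v \<le> ereal (real k)} \<rparr>"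

definition proper_coloring :: "'a pair_pre_digraph \<Rightarrow> ('a \<Rightarrow> 'c) \<Rightarrow> bool" where
  "proper_coloring G f \<longleftrightarrow> (\<forall>(u, v) \<in> parcs G. f u \<noteq> f v)"

definition chromatic_number :: "'a pair_pre_digraph \<Rightarrow> nat" where
  "chromatic_number G =
     (LEAST n. \<exists>f :: 'a \<Rightarrow> nat. proper_coloring G f \<and> (\<forall>v \<in> pverts G. f v < n))"

text \<open>
  Colours are natural numbers, which loses nothing: the finitely many finite lists on a finite
  graph can be renamed injectively (lemma \<open>choosable_any_colors\<close> below).  Finiteness of the lists
  is stated separately because \<^term>\<open>card\<close> of an infinite set is \<open>0\<close>.
\<close>

definition choosable :: "'a pair_pre_digraph \<Rightarrow> nat \<Rightarrow> bool" where
  "choosable G t \<longleftrightarrow>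
     (\<forall>L :: 'a \<Rightarrow> nat set. (\<forall>v \<in> pverts G. finite (L v) \<and> card (L v) = t) \<longrightarrow>
        (\<exists>f. proper_coloring G f \<and> (\<forall>v \<in> pverts G. f v \<in> L v)))"

definition list_chromatic_number :: "'a pair_pre_digraph \<Rightarrow> nat" where
  "list_chromatic_number G = (LEAST t. choosable G t)"

lemma graph_dist_le_iff:
  assumes "pair_graph G"
  shows "graph_dist G u v \<le> ereal (real k) \<longleftrightarrow>
    (\<exists>p. pre_digraph.awalk (with_proj G) u p v \<and> length p \<le> k)"
proof -
  interpret pair_graph G by fact
  have cost: "awalk_cost (\<lambda>_. 1) p = real (length p)" for p :: "('a \<times> 'a) list"
    by (induction p) (auto simp: awalk_cost_def)
  show ?thesis
  proof
    assume le: "graph_dist G u v \<le> ereal (real k)"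
    show "\<exists>p. awalk u p v \<and> length p \<le> k"
    proof (rule ccontr)
      assume "\<not> ?thesis"
      then have "ereal (real (Suc k)) \<le> ereal (awalk_cost (\<lambda>_. 1) p)" if "awalk u p v" for p
        using that by (force simp: cost)
      then have "ereal (real (Suc k)) \<le> graph_dist G u v"
        unfolding graph_dist_def \<mu>_def by (intro INF_greatest) auto
      with le have "ereal (real (Suc k)) \<le> ereal (real k)" by (rule order_trans[rotated])
      then show False by simp
    qed
  next
    assume "\<exists>p. awalk u p v \<and> length p \<le> k"
    then obtain p where p: "awalk u p v" "length p \<le> k" by blast
    have "graph_dist G u v \<le> ereal (awalk_cost (\<lambda>_. 1) p)"
      unfolding graph_dist_def by (rule min_cost_le_walk_cost) (fact p)
    also have "\<dots> \<le> ereal (real k)" using p by (simp add: cost)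
    finally show "graph_dist G u v \<le> ereal (real k)" .
  qed
qed

lemma graph_dist_sym:
  assumes "pair_graph G"
  shows "graph_dist G u v \<le> ereal (real k) \<Longrightarrow> graph_dist G v u \<le> ereal (real k)"
proof -
  interpret pair_graph G by fact
  have rev: "\<exists>q. awalk v q u \<and> length q = length p" if "awalk u p v" for p
    using that
  proof (induction p arbitrary: u)
    case Nil
    then show ?case by (auto simp: awalk_Nil_iff)
  next
    case (Cons e p)
    obtain x y where e: "e = (x, y)" by (cases e)
    from Cons.prems e have x: "x = u" "(u, y) \<in> parcs G" and w: "awalk y p v"
      by (auto simp: awalk_Cons_iff)
    from Cons.IH[OF w] obtain q where q: "awalk v q y" "length q = length p" by blast
    have "(y, u) \<in> parcs G"
      using x pair_sym_arcs by (auto simp: symmetric_def sym_def)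
    then have "awalk y [(y, u)] u"
      by (auto simp: awalk_Cons_iff awalk_Nil_iff dest: in_arcsD2)
    with q have "awalk v (q @ [(y, u)]) u" by (auto intro: awalk_appendI)
    with q show ?case by (intro exI[of _ "q @ [(y, u)]"]) auto
  qed
  show "graph_dist G u v \<le> ereal (real k) \<Longrightarrow> graph_dist G v u \<le> ereal (real k)"
    unfolding graph_dist_le_iff[OF assms] using rev by metis
qed

lemma pair_graph_graph_power:
  assumes "pair_graph G"
  shows "pair_graph (graph_power G k)"
proof -
  interpret pair_graph G by fact
  have "parcs (graph_power G k) \<subseteq> pverts G \<times> pverts G"
    by (auto simp: graph_power_def)
  then have "finite (parcs (graph_power G k))"
    using finite_subset pair_finite_verts by blast
  then show ?thesis
    by unfold_locales
      (auto simp: graph_power_def symmetric_def pair_finite_verts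
        intro!: symI intro: graph_dist_sym[OF assms])
qed

lemma choosable_any_colors:
  fixes L :: "'a \<Rightarrow> 'c set"
  assumes G: "pair_graph G" and ch: "choosable G t"
    and L: "\<And>v. v \<in> pverts G \<Longrightarrow> finite (L v) \<and> card (L v) = t"
  shows "\<exists>f. proper_coloring G f \<and> (\<forall>v \<in> pverts G. f v \<in> L v)"
proof -
  interpret pair_graph G by fact
  define C where "C = (\<Union>v \<in> pverts G. L v)"
  have "finite C" using L pair_finite_verts by (auto simp: C_def)
  then obtain h :: "'c \<Rightarrow> nat" where h: "inj_on h C"
    using finite_imp_inj_to_nat_seg by blast
  have sub: "L v \<subseteq> C" if "v \<in> pverts G" for v using that by (auto simp: C_def)
  have "finite (h ` L v) \<and> card (h ` L v) = t" if "v \<in> pverts G" for v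
    using L[OF that] card_image[OF inj_on_subset[OF h sub[OF that]]] by simp
  then obtain f where f: "proper_coloring G f" "\<And>v. v \<in> pverts G \<Longrightarrow> f v \<in> h ` L v"
    using ch[unfolded choosable_def, THEN spec[of _ "\<lambda>v. h ` L v"]] by blast
  then have "\<forall>v \<in> pverts G. \<exists>c. c \<in> L v \<and> h c = f v" by force
  then obtain g where g: "\<And>v. v \<in> pverts G \<Longrightarrow> g v \<in> L v \<and> h (g v) = f v" by metis
  have "g u \<noteq> g v" if "(u, v) \<in> parcs G" for u v
    using that f(1) g[of u] g[of v] in_arcsD1[OF that] in_arcsD2[OF that]
    by (auto simp: proper_coloring_def)
  then have "proper_coloring G g" by (auto simp: proper_coloring_def)
  then show ?thesis using g by blast
qed

lemma choosable_card:
  assumes G: "pair_graph G"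
  shows "choosable G (card (pverts G))"
  unfolding choosable_def
proof (intro allI impI)
  fix L :: "'a \<Rightarrow> nat set"
  assume L: "\<forall>v \<in> pverts G. finite (L v) \<and> card (L v) = card (pverts G)"
  interpret pair_graph G by fact
  have "\<exists>f. inj_on f S \<and> (\<forall>v \<in> S. f v \<in> L v)" if "finite S" "S \<subseteq> pverts G" for S
    using that
  proof (induction S rule: finite_induct)
    case (insert x S)
    then obtain f where f: "inj_on f S" "\<forall>v \<in> S. f v \<in> L v" by auto
    have "card (f ` S) \<le> card S" by (simp add: card_image_le insert.hyps)
    also have "\<dots> < card (insert x S)" using insert.hyps by simp
    also have "\<dots> \<le> card (L x)" using insert.prems L pair_finite_verts
      by (metis card_mono insert_subset)
    finally have "\<not> L x \<subseteq> f ` S"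
      using card_mono[of "f ` S" "L x"] insert.hyps by auto
    then obtain c where c: "c \<in> L x" "c \<notin> f ` S" by blast
    have "inj_on (f(x := c)) (insert x S)"
      using f(1) c insert.hyps by (auto simp: inj_on_def)
    moreover have "\<forall>v \<in> insert x S. (f(x := c)) v \<in> L v" using f c by auto
    ultimately show ?case by blast
  qed auto
  from this[OF pair_finite_verts] obtain f
    where f: "inj_on f (pverts G)" "\<forall>v \<in> pverts G. f v \<in> L v" by blast
  have "f u \<noteq> f v" if "(u, v) \<in> parcs G" for u v
    using f(1) in_arcsD1[OF that] in_arcsD2[OF that] pair_no_loops[OF that]
    by (auto dest: inj_onD)
  then have "proper_coloring G f" by (auto simp: proper_coloring_def)
  then show "\<exists>f. proper_coloring G f \<and> (\<forall>v \<in> pverts G. f v \<in> L v)" using f by blast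
qed

end

theory Submission
  imports Defs
begin

text \<open>
  Let \<open>n = 2 ^ d\<close> and let \<open>m\<close> be the number of \<open>w\<close>-subsets of a set of size \<open>2 * w\<close>. The graph has
  \<open>n * m\<close> points \<open>(x, y)\<close>, where \<open>x\<close> is a subset of \<open>{..<d}\<close>. For all \<open>r < d\<close>, \<open>y\<close> and \<open>z\<close> there is a
  path whose ends are merged with the points \<open>(x, y)\<close>, \<open>r \<notin> x\<close>, at one end and with the points
  \<open>(x', z)\<close>, \<open>r \<in> x'\<close>, at the other, so that these points are at distance \<open>k\<close> at most. As any two
  different \<open>x\<close> and \<open>x'\<close> are separated by some \<open>r\<close>, the \<open>k\<close>th power induces on the points the
  complete multipartite graph with \<open>n\<close> parts of size \<open>m\<close>. For \<open>d = 6 * w\<close> and large \<open>w\<close> there are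
  at most \<open>d * m\<^sup>2 * k \<le> n\<close> other vertices, so the chromatic number is between \<open>n\<close> and \<open>2 * n\<close>. On
  the other hand, the lists \<open>y \<times> {..<n / 2}\<close> for the points \<open>(x, y)\<close>, of size \<open>w * n / 2\<close> of order
  \<open>n * log n\<close>, admit no proper colouring.
\<close>

section \<open>Walks\<close>

lemma awalk_of_sequence:
  assumes "pair_graph G" and "s 0 \<in> pverts G"
    and "\<And>i. i < k \<Longrightarrow> (s i, s (Suc i)) \<in> parcs G"
  shows "\<exists>p. pre_digraph.awalk (with_proj G) (s 0) p (s k) \<and> length p = k"
  using assms(3)
proof (induction k)
  interpret pair_graph G by fact
  {
    case 0
    show ?case using assms(2) by (auto simp: awalk_Nil_iff)
  next
    case (Suc k)
    then obtain p where p: "awalk (s 0) p (s k)" "length p = k" by auto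
    have "(s k, s (Suc k)) \<in> parcs G" using Suc.prems by simp
    then have "awalk (s k) [(s k, s (Suc k))] (s (Suc k))"
      by (auto simp: awalk_Cons_iff awalk_Nil_iff dest: in_arcsD2)
    with p show ?case by (intro exI[of _ "p @ [(s k, s (Suc k))]"]) (auto intro: awalk_appendI)
  }
qed

text \<open>Serves to bound distances from below: if \<open>\<phi>\<close> rises by more than
  \<open>k\<close> from \<open>u\<close> to \<open>v\<close>, no walk of length \<open>k\<close> or
  less joins them.\<close>

lemma awalk_lipschitz:
  fixes \<phi> :: "'a \<Rightarrow> nat"
  assumes "pair_graph G" and "\<And>u v. (u, v) \<in> parcs G \<Longrightarrow> \<phi> v \<le> Suc (\<phi> u)"
    and "pre_digraph.awalk (with_proj G) u p v"
  shows "\<phi> v \<le> \<phi> u + length p"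
  using assms(3)
proof (induction p arbitrary: u)
  interpret pair_graph G by fact
  {
    case Nil
    then show ?case by (auto simp: awalk_Nil_iff)
  next
    case (Cons e p)
    obtain x y where e: "e = (x, y)" by (cases e)
    from Cons.prems e have x: "(u, y) \<in> parcs G" and w: "awalk y p v"
      by (auto simp: awalk_Cons_iff)
    show ?case using Cons.IH[OF w] assms(2)[OF x] by simp
  }
qed

section \<open>Bounds on chromatic numbers\<close>

lemma proper_coloring_comp:
  assumes "pair_graph G" and "proper_coloring G f" and "inj_on h S"
    and "\<And>v. v \<in> pverts G \<Longrightarrow> f v \<in> S"
  shows "proper_coloring G (h \<circ> f)"
  unfolding proper_coloring_def
proof clarify
  interpret pair_graph G by fact
  fix u v assume uv: "(u, v) \<in> parcs G" and eq: "(h \<circ> f) u = (h \<circ> f) v"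
  have "f u = f v"
    using inj_onD[OF assms(3), of "f u" "f v"] eq assms(4) in_arcsD1[OF uv] in_arcsD2[OF uv] by simp
  then show False using assms(2) uv by (auto simp: proper_coloring_def)
qed

lemma proper_coloring_nat:
  assumes "pair_graph G" and "proper_coloring G f" and "finite S"
    and "\<And>v. v \<in> pverts G \<Longrightarrow> f v \<in> S"
  shows "\<exists>g :: 'a \<Rightarrow> nat. proper_coloring G g \<and> (\<forall>v \<in> pverts G. g v < card S)"
proof -
  obtain h where h: "bij_betw h S {0..<card S}"
    using ex_bij_betw_finite_nat[OF assms(3)] by blast
  have "proper_coloring G (h \<circ> f)"
    using assms h by (intro proper_coloring_comp[of G f h S]) (auto simp: bij_betw_def)
  moreover have "(h \<circ> f) v < card S" if "v \<in> pverts G" for v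
    using bij_betw_apply[OF h assms(4)[OF that]] by simp
  ultimately show ?thesis by blast
qed

lemma chromatic_number_le_card:
  assumes "pair_graph G" and "proper_coloring G f" and "finite S"
    and "\<And>v. v \<in> pverts G \<Longrightarrow> f v \<in> S"
  shows "chromatic_number G \<le> card S"
  unfolding chromatic_number_def by (rule Least_le) (rule proper_coloring_nat[OF assms])

lemma card_le_chromatic_number:
  assumes G: "pair_graph G" and K: "K \<subseteq> pverts G"
    and adj: "\<And>u v. u \<in> K \<Longrightarrow> v \<in> K \<Longrightarrow> u \<noteq> v \<Longrightarrow> (u, v) \<in> parcs G"
  shows "card K \<le> chromatic_number G"
proof -
  interpret pair_graph G by fact
  \<comment> \<open>\<open>id\<close> shows that some colouring exists, so that \<open>LEAST\<close>
    attains its value.\<close>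
  have "proper_coloring G id"
    unfolding proper_coloring_def by (auto dest: pair_no_loops)
  then have "\<exists>f :: 'a \<Rightarrow> nat. proper_coloring G f \<and> (\<forall>v \<in> pverts G. f v < card (pverts G))"
    by (rule proper_coloring_nat[OF G _ pair_finite_verts]) simp
  then have "\<exists>f :: 'a \<Rightarrow> nat. proper_coloring G f \<and> (\<forall>v \<in> pverts G. f v < chromatic_number G)"
    unfolding chromatic_number_def by (rule LeastI)
  then obtain f :: "'a \<Rightarrow> nat"
    where f: "proper_coloring G f" "\<forall>v \<in> pverts G. f v < chromatic_number G" by blast
  have "inj_on f K"
  proof (rule inj_onI, rule ccontr)
    fix u v assume "u \<in> K" "v \<in> K" "f u = f v" "u \<noteq> v"
    then show False using f(1) adj[of u v] by (auto simp: proper_coloring_def)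
  qed
  moreover have "f ` K \<subseteq> {..<chromatic_number G}" using f(2) K by auto
  ultimately show ?thesis using card_inj_on_le[of f K "{..<chromatic_number G}"] by simp
qed

lemma choosable_mono:
  assumes "choosable G s" and "s \<le> t"
  shows "choosable G t"
  unfolding choosable_def
proof (intro allI impI)
  fix L :: "'a \<Rightarrow> nat set"
  assume L: "\<forall>v \<in> pverts G. finite (L v) \<and> card (L v) = t"
  then have "\<forall>v \<in> pverts G. \<exists>M. M \<subseteq> L v \<and> card M = s \<and> finite M"
    using assms(2) by (metis obtain_subset_with_card_n)
  then obtain M where M: "\<forall>v \<in> pverts G. M v \<subseteq> L v \<and> card (M v) = s \<and> finite (M v)" by metis
  then show "\<exists>f. proper_coloring G f \<and> (\<forall>v \<in> pverts G. f v \<in> L v)"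
    using assms(1)[unfolded choosable_def, THEN spec[of _ M]] by blast
qed

text \<open>\<open>LEAST\<close> alone would allow a working size below the failing
  \<open>t\<close>; \<open>choosable_mono\<close> excludes that.\<close>

lemma less_list_chromatic_number:
  assumes "pair_graph G" and "\<not> choosable G t"
  shows "t < list_chromatic_number G"
proof -
  have "choosable G (list_chromatic_number G)"
    unfolding list_chromatic_number_def using choosable_card[OF assms(1)] by (rule LeastI)
  then show ?thesis using choosable_mono assms(2) not_le by blast
qed

section \<open>List colouring of complete multipartite graphs\<close>

definition halves :: "nat \<Rightarrow> nat set set" where
  "halves w = {y. y \<subseteq> {..<2 * w} \<and> card y = w}"

lemma finite_halves: "finite (halves w)"
  unfolding halves_def by (rule finite_subset[of _ "Pow {..<2 * w}"]) auto

lemma card_halves_le: "card (halves w) \<le> 2 ^ (2 * w)"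
proof -
  have "card (halves w) \<le> card (Pow {..<2 * w})"
    unfolding halves_def by (rule card_mono) auto
  then show ?thesis by (simp add: card_Pow)
qed

lemma lessThan_in_halves: "{..<w} \<in> halves w"
  by (auto simp: halves_def)

text \<open>
  The colours are \<open>2 * w\<close> groups of size \<open>g\<close>, and the list of a vertex is the union of the \<open>w\<close>
  groups in its label. Distinct parts receive disjoint sets of colours, so one of the \<open>2 * g\<close> parts
  receives at most \<open>w\<close> colours; these meet at most \<open>w\<close> groups, and a vertex of that part is labelled
  by \<open>w\<close> groups among the remaining ones.
\<close>

lemma multipartite_not_choosable:
  assumes G: "pair_graph G" and X: "card X = 2 * g" and g: "0 < g"
    and sub: "\<And>x. x \<in> X \<Longrightarrow> P x \<subseteq> pverts G"
    and adj: "\<And>x x' u v. x \<in> X \<Longrightarrow> x' \<in> X \<Longrightarrow> x \<noteq> x' \<Longrightarrow> u \<in> P x \<Longrightarrow> v \<in> P x' \<Longrightarrow>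
      (u, v) \<in> parcs G"
    and lab: "\<And>v. v \<in> pverts G \<Longrightarrow> lab v \<in> halves w"
    and full: "\<And>x. x \<in> X \<Longrightarrow> halves w \<subseteq> lab ` P x"
  shows "\<not> choosable G (w * g)"
proof
  assume ch: "choosable G (w * g)"
  interpret pair_graph G by fact
  have finX: "finite X" using X g by (intro card_ge_0_finite) simp
  have labsub: "lab v \<subseteq> {..<2 * w}" "finite (lab v)" "card (lab v) = w" if "v \<in> pverts G" for v
    using lab[OF that] finite_subset[of "lab v" "{..<2 * w}"] by (auto simp: halves_def)
  \<comment> \<open>A colour is a pair of a group and a member; \<open>choosable_any_colors\<close>
    admits such pairs in place of naturals.\<close>
  have "\<exists>f. proper_coloring G f \<and> (\<forall>v \<in> pverts G. f v \<in> lab v \<times> {..<g})"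
    using labsub by (intro choosable_any_colors[OF G ch]) (simp add: card_cartesian_product)
  then obtain f
    where f: "proper_coloring G f" "\<And>v. v \<in> pverts G \<Longrightarrow> f v \<in> lab v \<times> {..<g}" by blast
  define T where "T x = f ` P x" for x
  have finT: "finite (T x)" if "x \<in> X" for x
    using finite_subset[OF sub[OF that] pair_finite_verts] by (simp add: T_def)
  have disj: "T x \<inter> T x' = {}" if "x \<in> X" "x' \<in> X" "x \<noteq> x'" for x x'
  proof -
    have "f u \<noteq> f v" if "u \<in> P x" "v \<in> P x'" for u v
      using adj[OF \<open>x \<in> X\<close> \<open>x' \<in> X\<close> \<open>x \<noteq> x'\<close> that] f(1) by (auto simp: proper_coloring_def)
    then show ?thesis unfolding T_def disjoint_iff by (metis imageE)
  qed
  have "T x \<subseteq> {..<2 * w} \<times> {..<g}" if "x \<in> X" for x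
  proof -
    have "f v \<in> {..<2 * w} \<times> {..<g}" if "v \<in> P x" for v
    proof -
      have v: "v \<in> pverts G" using that sub \<open>x \<in> X\<close> by blast
      show ?thesis using f(2)[OF v] labsub(1)[OF v] by (auto simp: mem_Times_iff)
    qed
    then show ?thesis unfolding T_def by (rule image_subsetI)
  qed
  then have "card (\<Union>x \<in> X. T x) \<le> card ({..<2 * w} \<times> {..<g})"
    by (intro card_mono) auto
  also have "\<dots> = 2 * w * g" by (simp add: card_cartesian_product)
  finally have le: "(\<Sum>x \<in> X. card (T x)) \<le> 2 * w * g"
    using card_UN_disjoint[OF finX, of T] finT disj by simp
  have "\<exists>x \<in> X. card (T x) \<le> w"
  proof (rule ccontr)
    assume "\<not> ?thesis"
    then have "(\<Sum>x \<in> X. Suc w) \<le> (\<Sum>x \<in> X. card (T x))"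
      by (intro sum_mono) (auto simp: not_le Suc_le_eq)
    then show False using le X g by (simp add: algebra_simps)
  qed
  then obtain x where x: "x \<in> X" "card (T x) \<le> w" by blast
  have "card (fst ` T x) \<le> w" using card_image_le[OF finT[OF x(1)], of fst] x(2) by simp
  then have "w \<le> card ({..<2 * w} - fst ` T x)"
    using diff_card_le_card_Diff[of "fst ` T x" "{..<2 * w}"] finT[OF x(1)] by simp
  then obtain y where y: "y \<subseteq> {..<2 * w} - fst ` T x" "card y = w"
    by (metis obtain_subset_with_card_n)
  then have "y \<in> halves w" by (auto simp: halves_def)
  then obtain v where v: "v \<in> P x" "lab v = y" using full[OF x(1)] by blast
  then have "v \<in> pverts G" using sub[OF x(1)] by blast
  from f(2)[OF this] have "fst (f v) \<in> y" by (simp add: v(2) mem_Times_iff)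
  moreover have "fst (f v) \<in> fst ` T x" using v(1) by (simp add: T_def)
  ultimately show False using y(1) by blast
qed

section \<open>The construction\<close>

text \<open>An inner vertex does not record \<open>x\<close> and \<open>x'\<close>: one path serves
  all points that \<open>r\<close> separates, so the number of inner vertices is linear in
  \<open>d\<close> while there are \<open>2 ^ d\<close> parts.\<close>

datatype vertex =
  Point "nat set" "nat set"
| Inner nat "nat set" "nat set" nat

definition points :: "nat \<Rightarrow> nat \<Rightarrow> vertex set" where
  "points d w = (\<lambda>(x, y). Point x y) ` (Pow {..<d} \<times> halves w)"

definition inners :: "nat \<Rightarrow> nat \<Rightarrow> nat \<Rightarrow> vertex set" where
  "inners d w k = (\<lambda>(r, y, z, i). Inner r y z i) ` ({..<d} \<times> halves w \<times> halves w \<times> {0<..<k})"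

text \<open>Gives each choice of \<open>x\<close> and \<open>x'\<close> its own route through the
  shared path, with the merged ends as special cases.\<close>

definition station :: "nat \<Rightarrow> nat \<Rightarrow> nat set \<Rightarrow> nat set \<Rightarrow> nat set \<Rightarrow> nat set \<Rightarrow> nat \<Rightarrow> vertex" where
  "station k r x y x' z i =
     (if i = 0 then Point x y else if i = k then Point x' z else Inner r y z i)"

definition links :: "nat \<Rightarrow> nat \<Rightarrow> nat \<Rightarrow> (vertex \<times> vertex) set" where
  "links d w k = {(station k r x y x' z i, station k r x y x' z (Suc i)) | r x y x' z i.
     r < d \<and> x \<subseteq> {..<d} \<and> x' \<subseteq> {..<d} \<and> r \<notin> x \<and> r \<in> x' \<and>
     y \<in> halves w \<and> z \<in> halves w \<and> i < k}"

lemma card_inners_le: "card (inners d w k) \<le> d * (2 ^ (2 * w) * (2 ^ (2 * w) * k))"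
proof -
  have "card (inners d w k) \<le> card ({..<d} \<times> halves w \<times> halves w \<times> {0<..<k})"
    unfolding inners_def by (intro card_image_le finite_cartesian_product) (auto simp: finite_halves)
  also have "\<dots> = d * (card (halves w) * (card (halves w) * (k - 1)))"
    by (simp add: card_cartesian_product)
  also have "\<dots> \<le> d * (2 ^ (2 * w) * (2 ^ (2 * w) * k))"
    by (intro mult_le_mono card_halves_le) auto
  finally show ?thesis .
qed

lemma finite_points: "finite (points d w)"
  by (simp add: points_def finite_halves)

lemma finite_inners: "finite (inners d w k)"
  by (simp add: inners_def finite_halves)

lemma links_in_vertices:
  assumes "(u, v) \<in> links d w k"
  shows "u \<in> points d w \<union> inners d w k" and "v \<in> points d w \<union> inners d w k" and "u \<noteq> v"
proof -
  obtain r x y x' z i where uv: "u = station k r x y x' z i" "v = station k r x y x' z (Suc i)"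
    and *: "r < d" "x \<subseteq> {..<d}" "x' \<subseteq> {..<d}" "r \<notin> x" "r \<in> x'" "y \<in> halves w" "z \<in> halves w" "i < k"
    using assms by (auto simp: links_def)
  show "u \<in> points d w \<union> inners d w k" "v \<in> points d w \<union> inners d w k"
    using * unfolding uv by (auto simp: station_def points_def inners_def image_iff)
  \<comment> \<open>For \<open>k = 1\<close> both stations are points, told apart by
    \<open>r\<close>.\<close>
  show "u \<noteq> v" using * unfolding uv by (auto simp: station_def)
qed

text \<open>
  A lower bound for the distance from \<open>Point x0 y0\<close>. A path of length \<open>k\<close> is the only way to change
  the second component of a point, and it also changes the first one, so that \<open>Point x0 y\<close> with
  \<open>y \<noteq> y0\<close> has distance more than \<open>k\<close>. An inner vertex is described from the end of its path whose
  points agree with \<open>x0\<close> about \<open>r\<close>.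
\<close>

fun potential :: "nat \<Rightarrow> nat set \<Rightarrow> nat set \<Rightarrow> vertex \<Rightarrow> nat" where
  "potential k x0 y0 (Point x y) =
     (if y = y0 then (if x = x0 then 0 else 1) else (if x = x0 then Suc k else k))"
| "potential k x0 y0 (Inner r y z i) =
     (let (u, v, j) = (if r \<in> x0 then (z, y, k - i) else (y, z, i))
      in if u = y0 then (if v = y0 then 1 else j) else (if v = y0 then Suc k - j else k))"

text \<open>A point with first component \<open>x0\<close> can only lie at the end of a path that
  agrees with \<open>x0\<close> about \<open>r\<close>; the other end has potential \<open>1\<close>
  or \<open>k\<close>, and the inner values lead from end to end in steps of at most one. Both
  directions are stated because \<open>links\<close> is oriented.\<close>

lemma potential_lipschitz:
  assumes "(u, v) \<in> links d w k"
  shows "potential k x0 y0 v \<le> Suc (potential k x0 y0 u)"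
    and "potential k x0 y0 u \<le> Suc (potential k x0 y0 v)"
proof -
  obtain r x y x' z i where uv: "u = station k r x y x' z i" "v = station k r x y x' z (Suc i)"
    and *: "r \<notin> x" "r \<in> x'" "i < k"
    using assms by (auto simp: links_def)
  show "potential k x0 y0 v \<le> Suc (potential k x0 y0 u)"
    and "potential k x0 y0 u \<le> Suc (potential k x0 y0 v)"
    using * unfolding uv by (auto simp: station_def split: if_splits)
qed


section \<open>The graph and the colourings of its power\<close>

lemma exists_graph:
  assumes k: "0 < k" and w: "6 * k \<le> w"
  shows "\<exists>G :: nat pair_pre_digraph. pair_graph G \<and>
    2 ^ (6 * w) \<le> chromatic_number (graph_power G k) \<and>
    chromatic_number (graph_power G k) \<le> 2 * 2 ^ (6 * w) \<and>
    w * 2 ^ (6 * w - 1) < list_chromatic_number (graph_power G k)"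
proof -
  define d where "d = 6 * w"
  define V where "V = points d w \<union> inners d w k"
  \<comment> \<open>The vertices of the final graph are naturals: \<open>h\<close> encodes and
    \<open>b\<close> decodes.\<close>
  have "finite V" by (simp add: V_def finite_points finite_inners)
  then obtain h :: "vertex \<Rightarrow> nat" where h: "inj_on h V"
    using finite_imp_inj_to_nat_seg[of V] by blast
  define b where "b = inv_into V h"
  have b: "b (h u) = u" if "u \<in> V" for u
    using that h by (simp add: b_def)
  define E where "E = links d w k \<union> (links d w k)\<inverse>"
  have E: "u \<in> V" "v \<in> V" "u \<noteq> v" "(v, u) \<in> E" if "(u, v) \<in> E" for u v
    using that links_in_vertices[of u v d w k] links_in_vertices[of v u d w k]
    by (auto simp: E_def V_def)
  define G where "G = \<lparr> pverts = h ` V, parcs = map_prod h h ` E \<rparr>"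
  have "finite E"
    using E(1,2) \<open>finite V\<close> by (intro finite_subset[of E "V \<times> V"]) auto
  have G: "pair_graph G"
  proof
    show "finite (pverts G)" "finite (parcs G)"
      using \<open>finite V\<close> \<open>finite E\<close> by (auto simp: G_def)
    show "fst e \<in> pverts G" "snd e \<in> pverts G" "fst e \<noteq> snd e" if e: "e \<in> parcs G" for e
    proof -
      obtain u v where uv: "(u, v) \<in> E" "e = (h u, h v)" using e by (auto simp: G_def)
      show "fst e \<in> pverts G" "snd e \<in> pverts G" using uv E(1,2)[OF uv(1)] by (auto simp: G_def)
      show "fst e \<noteq> snd e" using uv E(1-3)[OF uv(1)] inj_onD[OF h, of u v] by auto
    qed
    show "symmetric (with_proj G)"
      unfolding symmetric_def
    proof (rule symI)
      fix a c assume "(a, c) \<in> arcs_ends (with_proj G)"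
      then obtain u v where "(u, v) \<in> E" "a = h u" "c = h v" by (auto simp: G_def arcs_ends_conv)
      then show "(c, a) \<in> arcs_ends (with_proj G)"
        using E(4)[of u v] by (force simp: G_def arcs_ends_conv)
    qed
  qed
  interpret pair_graph G by fact
  define A where "A = graph_power G k"
  have A: "pair_graph A" unfolding A_def by (rule pair_graph_graph_power[OF G])
  interpret A: pair_graph A by fact
  have vA: "pverts A = h ` V" by (simp add: A_def graph_power_def G_def)
  have pV: "Point x y \<in> V" if "x \<subseteq> {..<d}" "y \<in> halves w" for x y
    using that by (auto simp: V_def points_def)
  have adj1: "(h (Point x y), h (Point x' z)) \<in> parcs A"
    if x: "x \<subseteq> {..<d}" "x' \<subseteq> {..<d}" "r \<notin> x" "r \<in> x'" and y: "y \<in> halves w" "z \<in> halves w"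
    for x x' y z r
  proof -
    let ?s = "\<lambda>i. h (station k r x y x' z i)"
    have "(?s i, ?s (Suc i)) \<in> parcs G" if "i < k" for i
    proof -
      have "(station k r x y x' z i, station k r x y x' z (Suc i)) \<in> E"
        using that x y unfolding E_def links_def by blast
      then show ?thesis by (auto simp: G_def)
    qed
    moreover have "?s 0 \<in> pverts G" using pV[OF x(1) y(1)] by (simp add: station_def G_def)
    ultimately have "\<exists>p. awalk (?s 0) p (?s k) \<and> length p = k"
      using awalk_of_sequence[OF G, of ?s k] by blast
    \<comment> \<open>As \<open>0 < k\<close>, station \<open>k\<close> is the far end and not the
      start.\<close>
    then have "graph_dist G (h (Point x y)) (h (Point x' z)) \<le> ereal (real k)"
      unfolding graph_dist_le_iff[OF G] using k by (auto simp: station_def)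
    moreover have "h (Point x y) \<noteq> h (Point x' z)"
      using inj_onD[OF h _ pV[OF x(1) y(1)] pV[OF x(2) y(2)]] x by blast
    ultimately show ?thesis
      using pV[OF x(1) y(1)] pV[OF x(2) y(2)] by (simp add: A_def graph_power_def G_def)
  qed
  have adj: "(h (Point x y), h (Point x' z)) \<in> parcs A"
    if x: "x \<subseteq> {..<d}" "x' \<subseteq> {..<d}" "x \<noteq> x'" and y: "y \<in> halves w" "z \<in> halves w"
    for x x' y z
  proof -
    from \<open>x \<noteq> x'\<close> obtain r where "r \<notin> x \<and> r \<in> x' \<or> r \<notin> x' \<and> r \<in> x" by blast
    then show ?thesis
    proof
      assume "r \<notin> x \<and> r \<in> x'"
      then show ?thesis using adj1 x y by blast
    next
      assume "r \<notin> x' \<and> r \<in> x"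
      then have "(h (Point x' z), h (Point x y)) \<in> parcs A" using adj1 x y by blast
      moreover have "sym (parcs A)" using A.pair_sym_arcs by (simp add: symmetric_def)
      ultimately show ?thesis by (rule symD[rotated])
    qed
  qed
  \<comment> \<open>Each part is independent in the power, so a single colour will suffice for
    it.\<close>
  have nonadj: "(h (Point x y), h (Point x z)) \<notin> parcs A"
    if x: "x \<subseteq> {..<d}" and y: "y \<in> halves w" "z \<in> halves w" for x y z
  proof
    assume e: "(h (Point x y), h (Point x z)) \<in> parcs A"
    have "y \<noteq> z" using A.pair_no_loops[OF e] by auto
    define \<phi> where "\<phi> = potential k x y \<circ> b"
    from e have "graph_dist G (h (Point x y)) (h (Point x z)) \<le> ereal (real k)"
      by (simp add: A_def graph_power_def)
    then obtain p where p: "awalk (h (Point x y)) p (h (Point x z))" "length p \<le> k"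
      unfolding graph_dist_le_iff[OF G] by blast
    have "\<phi> v \<le> Suc (\<phi> u)" if "(u, v) \<in> parcs G" for u v
    proof -
      from that obtain u' v' where uv: "u = h u'" "v = h v'" "(u', v') \<in> E" by (auto simp: G_def)
      then show ?thesis
        using potential_lipschitz[of u' v' d w k x y] potential_lipschitz[of v' u' d w k x y]
          E(1,2)[OF uv(3)] by (auto simp: \<phi>_def b E_def)
    qed
    from awalk_lipschitz[of G \<phi>, OF G this p(1)] have "\<phi> (h (Point x z)) \<le> \<phi> (h (Point x y)) + k"
      using p(2) by linarith
    \<comment> \<open>The potential is \<open>0\<close> at the start and \<open>Suc k\<close> at the
      end.\<close>
    then show False using \<open>y \<noteq> z\<close> pV[OF x y(1)] pV[OF x y(2)] by (simp add: \<phi>_def b)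
  qed

  have "card (Pow {..<d}) \<le> chromatic_number A"
  proof -
    \<comment> \<open>A clique with one point from each part.\<close>
    define K where "K = (\<lambda>x. h (Point x {..<w})) ` Pow {..<d}"
    have "inj_on (\<lambda>x. h (Point x {..<w})) (Pow {..<d})"
      using inj_onD[OF h] pV lessThan_in_halves by (intro inj_onI) blast
    then have "card K = card (Pow {..<d})" unfolding K_def by (rule card_image)
    moreover have "card K \<le> chromatic_number A"
    proof (rule card_le_chromatic_number[OF A])
      show "K \<subseteq> pverts A" using pV lessThan_in_halves by (auto simp: K_def vA)
      fix u v assume "u \<in> K" "v \<in> K" "u \<noteq> v"
      then obtain x x' where "u = h (Point x {..<w})" "v = h (Point x' {..<w})"
        "x \<subseteq> {..<d}" "x' \<subseteq> {..<d}" "x \<noteq> x'" by (auto simp: K_def)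
      then show "(u, v) \<in> parcs A" using adj lessThan_in_halves by blast
    qed
    ultimately show ?thesis by simp
  qed
  then have lower: "2 ^ d \<le> chromatic_number A" by (simp add: card_Pow)

  have upper: "chromatic_number A \<le> 2 * 2 ^ d"
  proof -
    \<comment> \<open>One colour for each part and a private one for each inner vertex.\<close>
    define col where
      "col v = (case v of Point x y \<Rightarrow> Inl x | Inner r y z i \<Rightarrow> Inr v)" for v
    define S where "S = Inl ` Pow {..<d} \<union> Inr ` inners d w k"
    have "proper_coloring A (col \<circ> b)"
      unfolding proper_coloring_def
    proof clarify
      fix u v assume uv: "(u, v) \<in> parcs A" and eq: "(col \<circ> b) u = (col \<circ> b) v"
      obtain u' v' where u': "u = h u'" "u' \<in> V" and v': "v = h v'" "v' \<in> V"
        using A.in_arcsD1[OF uv] A.in_arcsD2[OF uv] by (auto simp: vA)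
      have "col u' = col v'" using eq u' v' by (simp add: b)
      moreover have "u' \<noteq> v'" using A.pair_no_loops[OF uv] u' v' by auto
      ultimately obtain x y z where "u' = Point x y" "v' = Point x z"
        by (auto simp: col_def split: vertex.splits)
      moreover from this have "x \<subseteq> {..<d}" "y \<in> halves w" "z \<in> halves w"
        using u'(2) v'(2) by (auto simp: V_def points_def inners_def)
      ultimately show False using nonadj uv u' v' by blast
    qed
    moreover have "finite S" by (simp add: S_def finite_inners)
    moreover have "(col \<circ> b) v \<in> S" if "v \<in> pverts A" for v
    proof -
      from that obtain u where u: "u \<in> V" "v = h u" by (auto simp: vA)
      then have "col u \<in> S"
        by (auto simp: V_def points_def col_def S_def image_iff split: vertex.splits)
          (auto simp: inners_def)
      then show ?thesis using u by (simp add: b)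
    qed
    ultimately have "chromatic_number A \<le> card S"
      by (rule chromatic_number_le_card[OF A, of "col \<circ> b" S])
    also have "\<dots> \<le> card (Pow {..<d}) + card (inners d w k)"
      unfolding S_def by (rule order_trans[OF card_Un_le]) (simp add: card_image)
    also have "\<dots> \<le> 2 ^ d + 2 ^ d"
    proof (rule add_mono)
      have "card (inners d w k) \<le> d * (2 ^ (2 * w) * (2 ^ (2 * w) * k))" by (rule card_inners_le)
      \<comment> \<open>The choice \<open>d = 6 * w\<close> pays for \<open>4 * w\<close> in the
        exponent from the two labels and \<open>w\<close> each from the factors \<open>w\<close> and
        \<open>6 * k \<le> w\<close>.\<close>
      also have "\<dots> = (w * (6 * k)) * (2 ^ (2 * w) * 2 ^ (2 * w))" by (simp add: d_def)
      also have "\<dots> \<le> (2 ^ w * 2 ^ w) * (2 ^ (2 * w) * 2 ^ (2 * w))"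
        using less_imp_le[OF less_exp[of w]] order_trans[OF w less_imp_le[OF less_exp]]
        by (intro mult_le_mono) simp_all
      also have "\<dots> = 2 ^ d" by (simp add: d_def flip: power_add)
      finally show "card (inners d w k) \<le> 2 ^ d" .
    qed (simp add: card_Pow)
    finally show ?thesis by simp
  qed

  \<comment> \<open>Here \<open>g = 2 ^ (d - 1)\<close> is half the number of parts. Inner vertices
    need lists of the same size; any half serves as their label.\<close>
  have "\<not> choosable A (w * 2 ^ (d - 1))"
  proof (rule multipartite_not_choosable[OF A,
        where X = "Pow {..<d}" and P = "\<lambda>x. (\<lambda>y. h (Point x y)) ` halves w"
          and lab = "\<lambda>v. case b v of Point x y \<Rightarrow> y | Inner _ _ _ _ \<Rightarrow> {..<w}"])
    show "card (Pow {..<d}) = 2 * 2 ^ (d - 1)"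
      using k w by (simp add: card_Pow d_def flip: power_Suc)
  next
    fix v assume "v \<in> pverts A"
    then obtain u where u: "u \<in> V" "b v = u" using b by (auto simp: vA)
    then show "(case b v of Point x y \<Rightarrow> y | Inner _ _ _ _ \<Rightarrow> {..<w}) \<in> halves w"
      using lessThan_in_halves by (cases u) (auto simp: V_def points_def inners_def)
  next
    fix x assume "x \<in> Pow {..<d}"
    then show "halves w \<subseteq> (\<lambda>v. case b v of Point x y \<Rightarrow> y | Inner _ _ _ _ \<Rightarrow> {..<w}) `
        (\<lambda>y. h (Point x y)) ` halves w"
      using pV[of x] by (simp add: image_image b)
  next
    fix x assume "x \<in> Pow {..<d}"
    then show "(\<lambda>y. h (Point x y)) ` halves w \<subseteq> pverts A" using pV by (auto simp: vA)
  next
    fix x x' u v assume "x \<in> Pow {..<d}" "x' \<in> Pow {..<d}" "x \<noteq> x'"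
      and "u \<in> (\<lambda>y. h (Point x y)) ` halves w" "v \<in> (\<lambda>y. h (Point x' y)) ` halves w"
    then show "(u, v) \<in> parcs A" using adj by blast
  qed simp
  then have "w * 2 ^ (d - 1) < list_chromatic_number A" by (rule less_list_chromatic_number[OF A])
  with lower upper G show ?thesis unfolding A_def d_def by (intro exI[of _ G] conjI)
qed

section \<open>The constant and the infinite family\<close>

text \<open>The factors of \<open>28\<close> are \<open>2\<close> from
  \<open>c \<le> 2 * 2 ^ (6 * w)\<close>, \<open>7\<close> from
  \<open>ln c \<le> (6 * w + 1) * ln 2 \<le> 7 * w\<close>, and \<open>2\<close> from
  \<open>2 ^ (6 * w - 1)\<close> being half of \<open>2 ^ (6 * w)\<close>.\<close>

lemma numeric_bound:
  assumes "0 < w" and "2 ^ (6 * w) \<le> c" and "c \<le> 2 * 2 ^ (6 * w)" and "w * 2 ^ (6 * w - 1) < l"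
  shows "real l \<ge> 1 / 28 * real c * ln (real c)"
proof -
  have "real c \<le> real (2 * 2 ^ (6 * w))" using assms(3) by (rule of_nat_mono)
  then have c: "real c \<le> 2 * 2 ^ (6 * w)" by simp
  have c0: "1 \<le> real c"
    using order_trans[OF one_le_power[of "2 :: nat" "6 * w"] assms(2)] by simp
  have "ln (real c) \<le> ln (2 ^ Suc (6 * w))" using c c0 by simp
  also have "\<dots> = real (Suc (6 * w)) * ln 2" by (rule ln_realpow)
  also have "\<dots> \<le> real (7 * w) * 1" using assms(1) ln_2_less_1 by (intro mult_mono) auto
  finally have ln: "ln (real c) \<le> 7 * real w" by simp
  have "1 / 28 * (real c * ln (real c)) \<le> 1 / 28 * (2 * 2 ^ (6 * w) * (7 * real w))"
    using c c0 ln by (intro mult_left_mono mult_mono) auto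
  also have "\<dots> = real w * (2 ^ (6 * w) / 2)" by simp
  also have "(2 :: real) ^ (6 * w) = 2 * 2 ^ (6 * w - 1)"
    using assms(1) by (simp flip: power_Suc)
  also have "real w * (2 * 2 ^ (6 * w - 1) / 2) = real (w * 2 ^ (6 * w - 1))" by simp
  also have "\<dots> \<le> real l" using less_imp_le[OF assms(4)] by (rule of_nat_mono)
  finally show ?thesis by (simp add: mult.assoc)
qed

theorem theorem3p4:
  shows "\<exists>c :: real. c > 0 \<and>
    (\<forall>k :: nat. k > 0 \<longrightarrow>
      (\<exists>\<G> :: nat pair_pre_digraph set.
        infinite \<G> \<and>
        (\<forall>G \<in> \<G>. pair_graph G) \<and>
        \<not> bdd_above {chromatic_number (graph_power G k) | G. G \<in> \<G>} \<and>
        (\<forall>G \<in> \<G>.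
          real (list_chromatic_number (graph_power G k)) \<ge>
            c * real (chromatic_number (graph_power G k)) * ln (real (chromatic_number (graph_power G k))))))"
proof (intro exI[of _ "1 / 28"] conjI allI impI)
  fix k :: nat assume k: "0 < k"
  let ?R = "\<lambda>w (G :: nat pair_pre_digraph). pair_graph G \<and>
    2 ^ (6 * w) \<le> chromatic_number (graph_power G k) \<and>
    chromatic_number (graph_power G k) \<le> 2 * 2 ^ (6 * w) \<and>
    w * 2 ^ (6 * w - 1) < list_chromatic_number (graph_power G k)"
  define \<G> where "\<G> = {G. \<exists>w. 6 * k \<le> w \<and> ?R w G}"
  let ?C = "{chromatic_number (graph_power G k) | G. G \<in> \<G>}"
  have unbounded: "\<not> bdd_above ?C"
  proof
    assume "bdd_above ?C"
    then obtain M where M: "\<And>G. G \<in> \<G> \<Longrightarrow> chromatic_number (graph_power G k) \<le> M"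
      by (auto simp: bdd_above_def)
    \<comment> \<open>Large enough that \<open>2 ^ (6 * w) > 6 * w \<ge> M\<close>.\<close>
    define w where "w = 6 * k + M"
    obtain G where G: "?R w G" using exists_graph[OF k, of w] by (auto simp: w_def)
    then have "G \<in> \<G>" unfolding \<G>_def w_def by (intro CollectI exI[of _ "6 * k + M"]) simp
    then have "2 ^ (6 * w) \<le> M" using M[of G] G by linarith
    moreover have "M \<le> 6 * w" by (simp add: w_def)
    ultimately show False using less_exp[of "6 * w"] by linarith
  qed
  have "infinite \<G>"
  proof
    assume "finite \<G>"
    then have "finite ?C" by simp
    then show False using unbounded by (simp add: bdd_above_finite)
  qed
  moreover have "real (list_chromatic_number (graph_power G k)) \<ge>
      1 / 28 * real (chromatic_number (graph_power G k)) * ln (real (chromatic_number (graph_power G k)))"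
    if "G \<in> \<G>" for G
  proof -
    from that[unfolded \<G>_def mem_Collect_eq] obtain w where w: "6 * k \<le> w \<and> ?R w G" ..
    then have "0 < w" using k by linarith
    with w show ?thesis using numeric_bound by blast
  qed
  moreover have "pair_graph G" if "G \<in> \<G>" for G using that by (auto simp: \<G>_def)
  ultimately show "\<exists>\<G> :: nat pair_pre_digraph set. infinite \<G> \<and> (\<forall>G \<in> \<G>. pair_graph G) \<and>
      \<not> bdd_above {chromatic_number (graph_power G k) | G. G \<in> \<G>} \<and>
      (\<forall>G \<in> \<G>. real (list_chromatic_number (graph_power G k)) \<ge>
        1 / 28 * real (chromatic_number (graph_power G k)) *
          ln (real (chromatic_number (graph_power G k))))"
    using unbounded by (intro exI[of _ \<G>] conjI ballI)
qed simp

end
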